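(* Consider the nonlinear system $\dot x(t)=f(x(t),w(t))$, $z(t)=h(x(t),w(t))$ under the standing assumptions in the context. Assume that the system is velocity dissipative (VD) under a storage function $\mathcal V_{\mathrm v}\in\mathcal C_1$ with respect to a supply function $s_{\mathrm v}:\mathbb R^{n_w}\times\mathbb R^{n_z}\to\mathbb R$ that satisfies $$s_{\mathrm v}(0,z_{\mathrm v})\le 0\qquad\text{for all } z_{\mathrm v}\in\mathbb R^{n_z}.$$ Then the system is universally shifted stable (USS). If moreover $s_{\mathrm v}(0,z_{\mathrm v})<0$ for all $z_{\mathrm v}\neq 0$ and the system is observable, then the system is universally shifted asymptotically stable (USAS).
   Context: System: $\dot x=f(x,w)$, $z=h(x,w)$ on $t\in[0,\infty)$, with $x(t)\in\mathcal X\subseteq\mathbb R^{n_x}$, $w(t)\in\mathcal W\subseteq\mathbb R^{n_w}$, $z(t)\in\mathcal Z\subseteq\mathbb R^{n_z}$, and $f:\mathcal X\times\mathcal W\to\mathbb R^{n_x}$, $h:\mathcal X\times\mathcal W\to\mathcal Z$ in $\mathcal C_1$ ($\mathcal C_n$ = $n$-times continuously differentiable functions). $\mathfrak B$ is the set of all $(x,w,z):[0,\infty)\to\mathcal X\times\mathcal W\times\mathcal Z$ with $x\in\mathcal C_1$ satisfying these equations; solutions are assumed forward complete and unique. Equilibria: $\mathscr E=\{(x_*,w_*,z_* )\in\mathcal X\times\mathcal W\times\mathcal Z: 0=f(x_*,w_* ),\ z_*=h(x_*,w_* )\}$, with projections $\mathscr X,\mathscr W,\mathscr Z$. Standing assumption: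 there is a bijection $\kappa:\mathscr W\to\mathscr X$ with $x_*=\kappa(w_* )$ for all equilibrium pairs $(x_*,w_* )$. $\mathfrak B^{\mathrm C}=\{(x,w,z)\in\mathfrak B: x\in\mathcal C_2,\ w,z\in\mathcal C_1\}$ (differentiability also at $t=0$), and $\mathfrak B^{\mathrm{VF}}=\{(\dot x,\dot w,\dot z):(x,w,z)\in\mathfrak B^{\mathrm C}\}$ is the set of time-derivative triples. In this velocity setting, the solutions of the system are those in $\mathfrak B^{\mathrm C}$. Class $\mathcal Q_{x_*}$: $V\in\mathcal Q_{x_*}$ if it is positive definite and decrescent with respect to $x_*$, i.e., there exist continuous strictly increasing $a,b:[0,\infty)\to[0,\infty)$ with $a(0)=b(0)=0$ and $a(\|x-x_*\|)\le V(x)\le b(\|x-x_*\|)$ for all $x$ in the domain. VD with respect to $s_{\mathrm v}$: there is a storage function $\mathcal V_{\mathrm v}:\mathbb R^{n_x}\to[0,\infty)$ with $\mathcal V_{\mathrm v}\in\mathcal C_1$, $\mathcal V_{\mathrm v}\in\mathcal Q_0$ such that $\mathcal V_{\mathrm v}(\dot x(t_1))-\mathcal V_{\mathrm v}(\dot x(t_0))\le\int_{t_0}^{t_1}s_{\mathrm v}(\dot w(t),\dot z(t))\,dt$ for all $0\le t_0\le t_1$ and all $(\dot x,\dot w,\dot z)\in\mathfrak B^{\mathrm{VF}}$. USS: for each $\epsilon>0$ and each equilibrium pair $(x_*,w_* )$ there is $\delta(\epsilon)>0$ such that $\|x(0)-x_*\|<\delta(\epsilon)$ implies $\|x(t)-x_*\|<\epsilon$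 for all $t\ge0$, for all state trajectories $x$ with constant input $w(t)= w_*$. USAS: USS and, for $w(t)=w_*$ for all $t$, $\|x(0)-x_*\|<\delta(\epsilon)$ implies $\lim_{t\to\infty}\|x(t)-x_*\|=0$. Observable: two initial states are indistinguishable if for every admissible input the two corresponding output trajectories coincide; the system is observable if indistinguishable initial states are equal.
   Formalization: The state set X is additionally assumed locally compact (e.g. open or closed), and "observable" is required under each constant equilibrium input w = w_* separately, rather than over all admissible inputs; without these the claims are false. *)

theory Defs
  imports "HOL-Analysis.Analysis"
begin

text \<open>Signals live on \<open>[0, \<infinity>)\<close>. They are modelled by functions on \<open>real\<close> of which only the values at
  \<open>t \<ge> 0\<close> matter; derivatives are taken within \<open>{0..}\<close>, hence one-sided at \<open>0\<close>.\<close>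

definition velocity :: "(real \<Rightarrow> 'a::real_normed_vector) \<Rightarrow> real \<Rightarrow> 'a" where
  "velocity x = (\<lambda>t. vector_derivative x (at t within {0..}))"

primrec Cn_signal :: "nat \<Rightarrow> (real \<Rightarrow> 'a::real_normed_vector) \<Rightarrow> bool" where
  "Cn_signal 0 x \<longleftrightarrow> continuous_on {0..} x"
| "Cn_signal (Suc n) x \<longleftrightarrow>
     (\<forall>t\<ge>0. x differentiable (at t within {0..})) \<and> Cn_signal n (velocity x)"

text \<open>On an open set this is the usual continuous differentiability.\<close>

definition C1_on :: "'a::real_normed_vector set \<Rightarrow> ('a \<Rightarrow> 'b::real_normed_vector) \<Rightarrow> bool" where
  "C1_on D g \<longleftrightarrow> (\<exists>g' :: 'a \<Rightarrow> 'a \<Rightarrow>\<^sub>L 'b.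
     (\<forall>p\<in>D. (g has_derivative blinfun_apply (g' p)) (at p within D)) \<and> continuous_on D g')"

record ('x, 'w, 'z) nlsys =
  states :: "'x set"
  inputs :: "'w set"
  outputs :: "'z set"
  dyn :: "'x \<times> 'w \<Rightarrow> 'x"
  out :: "'x \<times> 'w \<Rightarrow> 'z"

definition behaviour ::
  "('x::euclidean_space, 'w::euclidean_space, 'z::euclidean_space) nlsys
    \<Rightarrow> ((real \<Rightarrow> 'x) \<times> (real \<Rightarrow> 'w) \<times> (real \<Rightarrow> 'z)) set" where
  "behaviour S = {(x, w, z). Cn_signal 1 x \<and>
     (\<forall>t\<ge>0. x t \<in> states S \<and> w t \<in> inputs S \<and> z t \<in> outputs S \<and>
       (x has_vector_derivative dyn S (x t, w t)) (at t within {0..}) \<and>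
       z t = out S (x t, w t))}"

definition behaviour_C ::
  "('x::euclidean_space, 'w::euclidean_space, 'z::euclidean_space) nlsys
    \<Rightarrow> ((real \<Rightarrow> 'x) \<times> (real \<Rightarrow> 'w) \<times> (real \<Rightarrow> 'z)) set" where
  "behaviour_C S = {(x, w, z) \<in> behaviour S. Cn_signal 2 x \<and> Cn_signal 1 w \<and> Cn_signal 1 z}"

definition behaviour_VF ::
  "('x::euclidean_space, 'w::euclidean_space, 'z::euclidean_space) nlsys
    \<Rightarrow> ((real \<Rightarrow> 'x) \<times> (real \<Rightarrow> 'w) \<times> (real \<Rightarrow> 'z)) set" where
  "behaviour_VF S = {(velocity x, velocity w, velocity z) | x w z. (x, w, z) \<in> behaviour_C S}"

definition equilibria :: "('x::zero, 'w, 'z) nlsys \<Rightarrow> ('x \<times> 'w \<times> 'z) set" where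
  "equilibria S = {(xs, ws, zs) \<in> states S \<times> inputs S \<times> outputs S.
     0 = dyn S (xs, ws) \<and> zs = out S (xs, ws)}"

definition eq_states :: "('x::zero, 'w, 'z) nlsys \<Rightarrow> 'x set" where
  "eq_states S = {xs. \<exists>ws zs. (xs, ws, zs) \<in> equilibria S}"

definition eq_inputs :: "('x::zero, 'w, 'z) nlsys \<Rightarrow> 'w set" where
  "eq_inputs S = {ws. \<exists>xs zs. (xs, ws, zs) \<in> equilibria S}"

text \<open>The input signals are those of \<^const>\<open>behaviour_C\<close>, i.e. continuously differentiable ones.\<close>

definition forward_complete ::
  "('x::euclidean_space, 'w::euclidean_space, 'z::euclidean_space) nlsys \<Rightarrow> bool" where
  "forward_complete S \<longleftrightarrow>
     (\<forall>x0\<in>states S. \<forall>w. Cn_signal 1 w \<and> (\<forall>t\<ge>0. w t \<in> inputs S) \<longrightarrow>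
       (\<exists>x z. (x, w, z) \<in> behaviour S \<and> x 0 = x0))"

definition unique_solutions ::
  "('x::euclidean_space, 'w::euclidean_space, 'z::euclidean_space) nlsys \<Rightarrow> bool" where
  "unique_solutions S \<longleftrightarrow>
     (\<forall>x x' w z z'. (x, w, z) \<in> behaviour S \<and> (x', w, z') \<in> behaviour S \<and> x 0 = x' 0 \<longrightarrow>
       (\<forall>t\<ge>0. x t = x' t))"

definition standing_assumptions ::
  "('x::euclidean_space, 'w::euclidean_space, 'z::euclidean_space) nlsys \<Rightarrow> bool" where
  "standing_assumptions S \<longleftrightarrow>
     out S ` (states S \<times> inputs S) \<subseteq> outputs S \<and>
     C1_on (states S \<times> inputs S) (dyn S) \<and>
     C1_on (states S \<times> inputs S) (out S) \<and>
     forward_complete S \<and> unique_solutions S \<and>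
     (\<exists>\<kappa>. bij_betw \<kappa> (eq_inputs S) (eq_states S) \<and>
       (\<forall>(xs, ws, zs)\<in>equilibria S. xs = \<kappa> ws))"

definition class_Q :: "'x::euclidean_space set \<Rightarrow> 'x \<Rightarrow> ('x \<Rightarrow> real) \<Rightarrow> bool" where
  "class_Q D xs V \<longleftrightarrow>
     (\<exists>a b :: real \<Rightarrow> real.
       continuous_on {0..} a \<and> strict_mono_on {0..} a \<and> a 0 = 0 \<and>
       continuous_on {0..} b \<and> strict_mono_on {0..} b \<and> b 0 = 0 \<and>
       (\<forall>x\<in>D. a (norm (x - xs)) \<le> V x \<and> V x \<le> b (norm (x - xs))))"

text \<open>Integrability of the supply along velocity trajectories is part of the definition:
  \<^const>\<open>integral\<close> is \<open>0\<close> on non-integrable functions.\<close>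

definition velocity_dissipative ::
  "('x::euclidean_space, 'w::euclidean_space, 'z::euclidean_space) nlsys
    \<Rightarrow> ('w \<times> 'z \<Rightarrow> real) \<Rightarrow> bool" where
  "velocity_dissipative S s \<longleftrightarrow>
     (\<exists>V :: 'x \<Rightarrow> real. (\<forall>v. 0 \<le> V v) \<and> C1_on UNIV V \<and> class_Q UNIV 0 V \<and>
       (\<forall>(xv, wv, zv)\<in>behaviour_VF S. \<forall>t0 t1. 0 \<le> t0 \<and> t0 \<le> t1 \<longrightarrow>
         (\<lambda>t. s (wv t, zv t)) integrable_on {t0..t1} \<and>
         V (xv t1) - V (xv t0) \<le> integral {t0..t1} (\<lambda>t. s (wv t, zv t))))"

definition USS ::
  "('x::euclidean_space, 'w::euclidean_space, 'z::euclidean_space) nlsys \<Rightarrow> bool" where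
  "USS S \<longleftrightarrow>
     (\<forall>(xs, ws, zs)\<in>equilibria S. \<forall>\<epsilon>>0. \<exists>\<delta>>0.
       \<forall>(x, w, z)\<in>behaviour S. (\<forall>t\<ge>0. w t = ws) \<and> norm (x 0 - xs) < \<delta> \<longrightarrow>
         (\<forall>t\<ge>0. norm (x t - xs) < \<epsilon>))"

definition USAS ::
  "('x::euclidean_space, 'w::euclidean_space, 'z::euclidean_space) nlsys \<Rightarrow> bool" where
  "USAS S \<longleftrightarrow>
     (\<forall>(xs, ws, zs)\<in>equilibria S. \<forall>\<epsilon>>0. \<exists>\<delta>>0.
       \<forall>(x, w, z)\<in>behaviour S. (\<forall>t\<ge>0. w t = ws) \<and> norm (x 0 - xs) < \<delta> \<longrightarrow>
         (\<forall>t\<ge>0. norm (x t - xs) < \<epsilon>) \<and> ((\<lambda>t. norm (x t - xs)) \<longlongrightarrow> 0) at_top)"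

text \<open>Observability depends on the set \<open>U\<close> of admissible input signals; it gets stronger as \<open>U\<close> shrinks.\<close>

definition indistinguishable ::
  "('x::euclidean_space, 'w::euclidean_space, 'z::euclidean_space) nlsys
    \<Rightarrow> (real \<Rightarrow> 'w) set \<Rightarrow> 'x \<Rightarrow> 'x \<Rightarrow> bool" where
  "indistinguishable S U x0 x0' \<longleftrightarrow>
     (\<forall>w\<in>U. \<forall>x z x' z'. (x, w, z) \<in> behaviour S \<and> (x', w, z') \<in> behaviour S \<and>
        x 0 = x0 \<and> x' 0 = x0' \<longrightarrow> (\<forall>t\<ge>0. z t = z' t))"

definition observable ::
  "('x::euclidean_space, 'w::euclidean_space, 'z::euclidean_space) nlsys
    \<Rightarrow> (real \<Rightarrow> 'w) set \<Rightarrow> bool" where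
  "observable S U \<longleftrightarrow>
     (\<forall>x0\<in>states S. \<forall>x0'\<in>states S. indistinguishable S U x0 x0' \<longrightarrow> x0 = x0')"

text \<open>Asymptotic stability concerns each system with frozen equilibrium input. Observability of these
  systems is what it requires: with all constant inputs admissible at once, the system \<open>x' = J (x - w)\<close>,
  \<open>z = \<parallel>x - w\<parallel>\<^sup>2\<close> (\<open>J\<close> the planar rotation by a right angle) is observable and meets the other
  requirements for a suitable supply function, but all its trajectories with constant input are
  circles around the equilibrium.\<close>

definition eq_input_observable ::
  "('x::euclidean_space, 'w::euclidean_space, 'z::euclidean_space) nlsys \<Rightarrow> bool" where
  "eq_input_observable S \<longleftrightarrow> (\<forall>ws\<in>eq_inputs S. observable S {\<lambda>t. ws})"

end

theory Submission
  imports Defs "HOL-Complex_Analysis.Great_Picard"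
begin

text \<open>Freeze the input at an equilibrium value \<open>w\<^sub>*\<close>. Velocity dissipativity makes \<open>W(x) = V(f(x, w\<^sub>*))\<close>
  non-increasing along trajectories, and because \<open>\<kappa>\<close> is a function of \<open>w\<^sub>*\<close>, the field \<open>f(\<cdot>, w\<^sub>*)\<close> vanishes
  only at \<open>x\<^sub>*\<close>. So \<open>W\<close> is a Lyapunov function, and local compactness of the state set gives stability.

  For asymptotic stability, take a limit of time shifts of a bounded trajectory (LaSalle). It is again
  a trajectory, and \<open>W\<close> is constant along it, so \<open>s(0, z')\<close> has integral \<open>0\<close> and the output of the limit
  is constant. All its states are then indistinguishable, hence equal, and the limit rests at \<open>x\<^sub>*\<close>.
  No continuous dependence on initial values is needed.\<close>

section \<open>Trajectories of autonomous systems\<close>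

text \<open>A constant input is absorbed into \<open>g\<close>, which turns the system into an
  autonomous one. The set \<open>X\<close> will be either the whole state set or a compact part of
  it.\<close>

definition trajectory :: "('a::euclidean_space \<Rightarrow> 'a) \<Rightarrow> 'a set \<Rightarrow> (real \<Rightarrow> 'a) \<Rightarrow> bool" where
  "trajectory g X x \<longleftrightarrow>
     (\<forall>t\<ge>0. x t \<in> X \<and> (x has_vector_derivative g (x t)) (at t within {0..}))"

lemma trajectory_mem: "trajectory g X x \<Longrightarrow> 0 \<le> t \<Longrightarrow> x t \<in> X"
  by (simp add: trajectory_def)

lemma trajectory_deriv:
  "trajectory g X x \<Longrightarrow> 0 \<le> t \<Longrightarrow> (x has_vector_derivative g (x t)) (at t within {0..})"
  by (simp add: trajectory_def)

lemma trajectory_mono: "trajectory g X x \<Longrightarrow> X \<subseteq> Y \<Longrightarrow> trajectory g Y x"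
  by (auto simp: trajectory_def)

lemma trajectory_continuous_on: "trajectory g X x \<Longrightarrow> continuous_on {0..} x"
  by (auto simp: trajectory_def continuous_on_eq_continuous_within
      intro: has_vector_derivative_continuous)

lemma trajectory_shift:
  assumes x: "trajectory g X x" and u: "0 \<le> u"
  shows "trajectory g X (\<lambda>t. x (u + t))"
  unfolding trajectory_def
proof (intro allI impI conjI)
  fix t :: real assume t: "0 \<le> t"
  show "x (u + t) \<in> X"
    using trajectory_mem[OF x] u t by simp
  \<comment> \<open>The chain rule asks for the derivative relative to the shifted half-line, which
    lies in \<open>{0..}\<close> because \<open>u\<close> is nonnegative.\<close>
  have "(x has_vector_derivative g (x (u + t))) (at (u + t) within (+) u ` {0..})"
    by (rule has_vector_derivative_within_subset[OF trajectory_deriv[OF x]]) (use u t in auto)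
  moreover have "((+) u has_vector_derivative 1) (at t within {0..})"
    by (auto intro!: derivative_eq_intros)
  ultimately have "(x \<circ> (+) u has_vector_derivative 1 *\<^sub>R g (x (u + t))) (at t within {0..})"
    by (intro vector_diff_chain_within)
  then show "((\<lambda>t. x (u + t)) has_vector_derivative g (x (u + t))) (at t within {0..})"
    by (simp add: o_def)
qed

lemma trajectory_has_integral:
  assumes x: "trajectory g X x" and "0 \<le> a" "a \<le> b"
  shows "((\<lambda>t. g (x t)) has_integral (x b - x a)) {a..b}"
  using assms
  by (intro fundamental_theorem_of_calculus)
     (auto intro!: has_vector_derivative_within_subset[OF trajectory_deriv[OF x]])

text \<open>The increment is the integral of \<open>g\<close> along the path. The constant
  \<open>B\<close> depends only on \<open>g\<close> and \<open>X\<close>, so all time shifts of a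
  trajectory share it.\<close>

lemma trajectory_lipschitz:
  assumes x: "trajectory g X x" and B: "\<And>p. p \<in> X \<Longrightarrow> norm (g p) \<le> B"
    and ab: "0 \<le> a" "a \<le> b"
  shows "norm (x b - x a) \<le> B * (b - a)"
proof -
  have "0 \<le> B"
    using B[OF trajectory_mem[OF x order_refl]] norm_ge_zero order_trans by blast
  then have "norm (x b - x a) \<le> B * measure lborel (cbox a b)"
    using trajectory_has_integral[OF x ab] ab B trajectory_mem[OF x]
    by (intro has_integral_bound[where f="\<lambda>t. g (x t)"]) auto
  then show ?thesis
    using ab by simp
qed

text \<open>Integral equations pass to pointwise limits under domination, while derivatives need
  not, so limits are recognised as trajectories in this form. Integrability makes \<open>y\<close>
  continuous; then the integrand is continuous and the fundamental theorem yields the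
  derivative.\<close>

lemma trajectory_of_integral:
  fixes y :: "real \<Rightarrow> 'a::euclidean_space"
  assumes g: "continuous_on X g" and y: "\<And>t. 0 \<le> t \<Longrightarrow> y t \<in> X"
    and int: "\<And>t. 0 \<le> t \<Longrightarrow> ((\<lambda>s. g (y s)) has_integral (y t - y 0)) {0..t}"
  shows "trajectory g X y"
  unfolding trajectory_def
proof (intro allI impI conjI)
  fix t :: real assume t: "0 \<le> t"
  show "y t \<in> X" using y t .
  \<comment> \<open>Reaching beyond \<open>t\<close> makes the derivative at \<open>t\<close> within
    this interval agree with the one within \<open>{0..}\<close>.\<close>
  let ?I = "{0..t + 1}"
  have eq: "y s = y 0 + integral {0..s} (\<lambda>s. g (y s))" if "s \<in> ?I" for s
    using integral_unique[OF int[of s]] that by simp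
  have "(\<lambda>s. g (y s)) integrable_on ?I"
    using int[of "t + 1"] t by (auto simp: integrable_on_def)
  then have "continuous_on ?I (\<lambda>s. y 0 + integral {0..s} (\<lambda>s. g (y s)))"
    by (intro continuous_intros indefinite_integral_continuous_1)
  then have "continuous_on ?I y"
    by (rule continuous_on_eq) (rule eq[symmetric])
  then have "continuous_on ?I (\<lambda>s. g (y s))"
    by (rule continuous_on_compose2[OF g]) (auto intro: y)
  then have "((\<lambda>s. y 0 + integral {0..s} (\<lambda>s. g (y s))) has_vector_derivative 0 + g (y t))
      (at t within ?I)"
    using t by (intro has_vector_derivative_add has_vector_derivative_const
        integral_has_vector_derivative) auto
  then have "(y has_vector_derivative g (y t)) (at t within ?I)"
    using t by (intro has_vector_derivative_transform[of t ?I y, OF _ eq]) auto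
  moreover have "at t within ?I = at t within {0..}"
    by (rule at_within_nhd[of t "{..<t + 1}"]) auto
  ultimately show "(y has_vector_derivative g (y t)) (at t within {0..})" by simp
qed

text \<open>Equi-Lipschitz continuity extends convergence from the rational times to all times, and
  dominated convergence carries the integral equation over to the limit.\<close>

lemma trajectory_shifts_subsequence:
  fixes x :: "real \<Rightarrow> 'a::euclidean_space"
  assumes K: "compact K" and g: "continuous_on K g" and x: "trajectory g K x"
    and u: "\<And>n::nat. 0 \<le> u n"
  obtains k y where "strict_mono k" "trajectory g K y"
    "\<And>t. 0 \<le> t \<Longrightarrow> (\<lambda>n. x (u (k n) + t)) \<longlonglongrightarrow> y t"
proof -
  obtain M where M: "\<And>p. p \<in> K \<Longrightarrow> norm p \<le> M"
    using compact_imp_bounded[OF K] by (auto simp: bounded_iff)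
  obtain B where B: "\<And>p. p \<in> K \<Longrightarrow> norm (g p) \<le> B" and "0 < B"
    using compact_imp_bounded[OF compact_continuous_image[OF g K]]
    unfolding bounded_pos by auto
  define f where "f n t = x (u n + t)" for n t
  have f: "trajectory g K (f n)" for n
    unfolding f_def using trajectory_shift[OF x u] .
  \<comment> \<open>Diagonal extraction: the values are bounded by \<open>M\<close> and the
    nonnegative rationals are countable.\<close>
  obtain k where k: "strict_mono k"
    and conv: "\<And>q. q \<in> {q\<in>\<rat>. 0 \<le> q} \<Longrightarrow> \<exists>l. (\<lambda>n. f (k n) q) \<longlonglongrightarrow> l"
  proof (rule function_convergent_subsequence[of "{q\<in>\<rat>. 0 \<le> q}" f M])
    show "countable {q \<in> \<rat>. 0 \<le> (q::real)}"
      using countable_rat by (rule countable_subset[rotated]) auto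
    show "norm (f n q) \<le> M" if "q \<in> {q \<in> \<rat>. 0 \<le> q}" for n q
      using M trajectory_mem[OF f] that by auto
  qed auto
  have "convergent (\<lambda>n. f (k n) t)" if t: "0 \<le> t" for t
  proof -
    have "Cauchy (\<lambda>n. f (k n) t)"
    proof (rule metric_CauchyI)
      fix e :: real assume e: "0 < e"
      \<comment> \<open>Since \<open>B\<close> bounds all speeds, this choice keeps
        \<open>f n t\<close> within \<open>e / 3\<close> of \<open>f n q\<close> for every
        \<open>n\<close> at once.\<close>
      obtain q where q: "q \<in> \<rat>" "t < q" "q < t + e / (3 * B)"
        using Rats_dense_in_real[of t "t + e / (3 * B)"] e \<open>0 < B\<close> by auto
      have close: "dist (f n t) (f n q) < e / 3" for n
      proof -
        have "norm (f n q - f n t) \<le> B * (q - t)"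
          using trajectory_lipschitz[OF f B, of t q n] t q by simp
        also have "\<dots> < e / 3"
          using q \<open>0 < B\<close> by (simp add: field_simps)
        finally show ?thesis by (simp add: dist_norm norm_minus_commute)
      qed
      have "Cauchy (\<lambda>n. f (k n) q)"
        using conv[of q] q t by (auto intro: LIMSEQ_imp_Cauchy)
      then obtain N where N: "\<And>m n. N \<le> m \<Longrightarrow> N \<le> n \<Longrightarrow> dist (f (k m) q) (f (k n) q) < e / 3"
        using e by (metis metric_CauchyD zero_less_divide_iff zero_less_numeral)
      show "\<exists>N. \<forall>m\<ge>N. \<forall>n\<ge>N. dist (f (k m) t) (f (k n) t) < e"
      proof (intro exI allI impI)
        fix m n assume "N \<le> m" "N \<le> n"
        then show "dist (f (k m) t) (f (k n) t) < e"
          using dist_triangle_third[OF close[of "k m"] N[of m n], of "f (k n) t"] close[of "k n"]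
          by (simp add: dist_commute)
      qed
    qed
    then show ?thesis by (simp add: Cauchy_convergent_iff)
  qed
  then obtain y where y: "\<And>t. 0 \<le> t \<Longrightarrow> (\<lambda>n. f (k n) t) \<longlonglongrightarrow> y t"
    unfolding convergent_def by metis
  have yK: "y t \<in> K" if "0 \<le> t" for t
    using closed_sequentially[OF compact_imp_closed[OF K] _ y[OF that]] trajectory_mem[OF f that]
    by blast
  have gy: "(\<lambda>n. g (f (k n) t)) \<longlonglongrightarrow> g (y t)" if "0 \<le> t" for t
    using continuous_on_tendsto_compose[OF g y yK] trajectory_mem[OF f] that by auto
  have "trajectory g K y"
  proof (rule trajectory_of_integral[OF g yK])
    fix t :: real assume t: "0 \<le> t"
    show "((\<lambda>s. g (y s)) has_integral (y t - y 0)) {0..t}"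
    proof (rule has_integral_dominated_convergence)
      show "((\<lambda>s. g (f (k n) s)) has_integral (f (k n) t - f (k n) 0)) {0..t}" for n
        using trajectory_has_integral[OF f] t by simp
      show "(\<lambda>s. B) integrable_on {0..t}" by auto
      show "\<forall>s\<in>{0..t}. norm (g (f (k n) s)) \<le> B" for n
        using B trajectory_mem[OF f] by auto
      show "\<forall>s\<in>{0..t}. (\<lambda>n. g (f (k n) s)) \<longlonglongrightarrow> g (y s)"
        using gy by auto
      show "(\<lambda>n. f (k n) t - f (k n) 0) \<longlonglongrightarrow> y t - y 0"
        using y t by (intro tendsto_diff) auto
    qed
  qed auto
  with k y show thesis
    using that unfolding f_def by blast
qed

section \<open>Lyapunov and LaSalle arguments\<close>

text \<open>On the part of a small sphere around \<open>xs\<close> that lies in \<open>X\<close>,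
  \<open>W\<close> has a positive lower bound \<open>m\<close>. A path that starts inside with
  \<open>W < m\<close> and never exceeds its initial value of \<open>W\<close> cannot cross the
  sphere. The compact set is returned as well because the convergence argument takes place in
  it.\<close>

lemma Lyapunov_stable:
  fixes X :: "'a::euclidean_space set" and W :: "'a \<Rightarrow> real"
  assumes X: "locally compact X" "xs \<in> X"
    and W: "continuous_on X W" "W xs = 0" "\<And>p. p \<in> X \<Longrightarrow> p \<noteq> xs \<Longrightarrow> 0 < W p"
    and "0 < \<epsilon>"
  obtains r \<delta> where "r < \<epsilon>" "0 < \<delta>" "compact (X \<inter> cball xs r)"
    "\<And>(x :: real \<Rightarrow> 'a) t. continuous_on {0..} x \<Longrightarrow> (\<And>t. 0 \<le> t \<Longrightarrow> x t \<in> X) \<Longrightarrow>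
       (\<And>t. 0 \<le> t \<Longrightarrow> W (x t) \<le> W (x 0)) \<Longrightarrow> norm (x 0 - xs) < \<delta> \<Longrightarrow> 0 \<le> t \<Longrightarrow>
       x t \<in> X \<inter> cball xs r"
proof -
  obtain e where e: "0 < e" "closed (cball xs e \<inter> X)"
    using X by (auto simp: locally_compact_Int_cball)
  \<comment> \<open>The bound by \<open>e\<close> gives compactness of the intersection with
    \<open>X\<close>; halving \<open>\<epsilon>\<close> makes \<open>r < \<epsilon>\<close>
    strict.\<close>
  define r where "r = min e (\<epsilon> / 2)"
  have r: "0 < r" "r < \<epsilon>" "r \<le> e"
    using e \<open>0 < \<epsilon>\<close> by (auto simp: r_def)
  have "X \<inter> cball xs r = cball xs r \<inter> (cball xs e \<inter> X)"
    using r by auto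
  then have K: "compact (X \<inter> cball xs r)"
    using e(2) by (simp add: compact_Int_closed)
  have sphere: "compact (X \<inter> sphere xs r)"
  proof -
    have "X \<inter> sphere xs r = (X \<inter> cball xs r) \<inter> sphere xs r" by auto
    then show ?thesis using K by (simp add: compact_Int)
  qed
  \<comment> \<open>The minimum of \<open>W\<close> over the sphere inside \<open>X\<close>, or the
    arbitrary value 1 if that set is empty.\<close>
  obtain m where m: "0 < m" "\<And>p. p \<in> X \<Longrightarrow> norm (p - xs) = r \<Longrightarrow> m \<le> W p"
  proof (cases "X \<inter> sphere xs r = {}")
    case True
    then show ?thesis
      by (intro that[of 1]) (auto simp: dist_norm norm_minus_commute)
  next
    case False
    then obtain p where p: "p \<in> X \<inter> sphere xs r" "\<And>q. q \<in> X \<inter> sphere xs r \<Longrightarrow> W p \<le> W q"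
      using continuous_attains_inf[OF sphere] continuous_on_subset[OF W(1)] by (metis inf_le1)
    then have "0 < W p"
      using W(3) r by auto
    with p show ?thesis
      by (intro that[of "W p"]) (auto simp: dist_norm norm_minus_commute)
  qed
  obtain d where d: "0 < d" "\<And>p. p \<in> X \<Longrightarrow> dist p xs < d \<Longrightarrow> dist (W p) (W xs) < m"
    using W(1) X(2) m(1) unfolding continuous_on_iff by metis
  show thesis
  \<comment> \<open>The bound by \<open>d\<close> gives \<open>W (x 0) < m\<close> by continuity;
    the bound by \<open>r\<close> puts the start inside the sphere.\<close>
  proof (rule that[of r "min d r"])
    show "r < \<epsilon>" "0 < min d r" "compact (X \<inter> cball xs r)"
      using d r K by auto
    fix x :: "real \<Rightarrow> 'a" and t :: real
    assume x: "continuous_on {0..} x" "\<And>t. 0 \<le> t \<Longrightarrow> x t \<in> X"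
      "\<And>t. 0 \<le> t \<Longrightarrow> W (x t) \<le> W (x 0)" and x0: "norm (x 0 - xs) < min d r" and t: "0 \<le> t"
    have "W (x 0) < m"
      using d(2)[OF x(2)[of 0]] x0 W(2) by (auto simp: dist_norm)
    have "norm (x t - xs) \<le> r"
    proof (rule ccontr)
      assume "\<not> norm (x t - xs) \<le> r"
      moreover have "continuous_on {0..t} (\<lambda>t. norm (x t - xs))"
        by (intro continuous_intros continuous_on_subset[OF x(1)]) auto
      \<comment> \<open>A path leaving the ball meets the sphere at some time \<open>\<tau>\<close>,
        where \<open>W\<close> is at least \<open>m\<close>.\<close>
      ultimately obtain \<tau> where "0 \<le> \<tau>" "norm (x \<tau> - xs) = r"
        using IVT'[of "\<lambda>t. norm (x t - xs)" 0 r t] x0 t by auto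
      then show False
        using m(2)[OF x(2)] x(3)[of \<tau>] \<open>W (x 0) < m\<close> by fastforce
    qed
    then show "x t \<in> X \<inter> cball xs r"
      using x(2) t by (simp add: dist_norm norm_minus_commute)
  qed
qed

lemma tendsto_at_top_nonincreasing:
  fixes f :: "real \<Rightarrow> real"
  assumes dec: "\<And>s t. 0 \<le> s \<Longrightarrow> s \<le> t \<Longrightarrow> f t \<le> f s" and lb: "\<And>t. 0 \<le> t \<Longrightarrow> m \<le> f t"
  obtains c where "(f \<longlongrightarrow> c) at_top"
proof
  have bdd: "bdd_below (f ` {0..})"
    using lb by (intro bdd_belowI2[of _ m]) auto
  show "(f \<longlongrightarrow> Inf (f ` {0..})) at_top"
  proof (rule decreasing_tendsto)
    show "\<forall>\<^sub>F t in at_top. Inf (f ` {0..}) \<le> f t"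
      using eventually_ge_at_top[of 0] by eventually_elim (auto intro: cInf_lower[OF _ bdd])
    fix b assume "Inf (f ` {0..}) < b"
    then obtain s where s: "0 \<le> s" "f s < b"
      using bdd by (auto simp: cInf_less_iff)
    show "\<forall>\<^sub>F t in at_top. f t < b"
      using eventually_ge_at_top[of s] by eventually_elim (use dec s in force)
  qed
qed

text \<open>Otherwise there are times \<open>u n\<close> tending to infinity at which
  \<open>x\<close> keeps distance at least \<open>e\<close> from \<open>p\<close>. Let
  \<open>y\<close> be a limit of the shifts by these times. Since \<open>W\<close> converges along
  \<open>x\<close>, it is constant along \<open>y\<close>; then \<open>inv\<close> gives
  \<open>y 0 = p\<close>, against the distance.\<close>

lemma LaSalle:
  fixes x :: "real \<Rightarrow> 'a::euclidean_space" and W :: "'a \<Rightarrow> real"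
  assumes K: "compact K" and g: "continuous_on K g" and W: "continuous_on K W"
    and x: "trajectory g K x"
    and dec: "\<And>s t. 0 \<le> s \<Longrightarrow> s \<le> t \<Longrightarrow> W (x t) \<le> W (x s)"
    and inv: "\<And>y. trajectory g K y \<Longrightarrow> (\<And>t. 0 \<le> t \<Longrightarrow> W (y t) = W (y 0)) \<Longrightarrow> y 0 = p"
  shows "(x \<longlongrightarrow> p) at_top"
proof (rule ccontr)
  assume "\<not> ?thesis"
  then obtain e where e: "0 < e" "\<not> (\<forall>\<^sub>F t in at_top. dist (x t) p < e)"
    unfolding tendsto_iff by blast
  then have "\<exists>u. real n \<le> u \<and> e \<le> dist (x u) p" for n
    unfolding eventually_at_top_linorder by (meson not_le)
  then obtain u where u: "\<And>n::nat. real n \<le> u n" "\<And>n. e \<le> dist (x (u n)) p"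
    by metis
  have u0: "0 \<le> u n" for n
    using u(1)[of n] by linarith
  obtain k y where k: "strict_mono k" and y: "trajectory g K y"
    and lim: "\<And>t. 0 \<le> t \<Longrightarrow> (\<lambda>n. x (u (k n) + t)) \<longlonglongrightarrow> y t"
    using trajectory_shifts_subsequence[where u=u, OF K g x u0] by blast
  obtain B where B: "\<And>q. q \<in> K \<Longrightarrow> \<bar>W q\<bar> \<le> B"
    using compact_imp_bounded[OF compact_continuous_image[OF W K]] by (auto simp: bounded_iff)
  obtain c where c: "((\<lambda>t. W (x t)) \<longlongrightarrow> c) at_top"
  proof (rule tendsto_at_top_nonincreasing[OF dec])
    show "- B \<le> W (x t)" if "0 \<le> t" for t
      using B[OF trajectory_mem[OF x that]] by linarith
  qed auto
  have Wy: "W (y t) = c" if t: "0 \<le> t" for t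
  proof (rule LIMSEQ_unique)
    show "(\<lambda>n. W (x (u (k n) + t))) \<longlonglongrightarrow> W (y t)"
      using continuous_on_tendsto_compose[OF W lim[OF t] trajectory_mem[OF y t]]
        trajectory_mem[OF x] u0 t by simp
    have "n \<le> u (k n) + t" for n
      using u(1)[of "k n"] seq_suble[OF k, of n] t by linarith
    then have "filterlim (\<lambda>n. u (k n) + t) at_top sequentially"
      by (intro filterlim_at_top_mono[OF filterlim_real_sequentially] always_eventually) auto
    then show "(\<lambda>n. W (x (u (k n) + t))) \<longlonglongrightarrow> c"
      by (rule filterlim_compose[OF c])
  qed
  then have "y 0 = p"
    by (intro inv[OF y]) auto
  then have "(\<lambda>n. dist (x (u (k n))) p) \<longlonglongrightarrow> 0"
    using lim[of 0] by (simp add: tendsto_dist_iff[symmetric])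
  then have "e \<le> 0"
    by (rule LIMSEQ_le_const) (use u(2) in auto)
  with e show False by simp
qed

section \<open>Constant inputs\<close>

lemma velocity_eq:
  assumes "(x has_vector_derivative v) (at t within {0..})" "0 \<le> t"
  shows "velocity x t = v"
proof -
  \<comment> \<open>Each \<open>t \<ge> 0\<close>, including 0, is a limit point of the half-line
    from the right, so the derivative is unique.\<close>
  have "at_right t \<le> at t within {0..}"
    by (rule at_le) (use assms(2) in auto)
  then have "at t within {0..} \<noteq> bot"
    using trivial_limit_at_right_real[of t] by (metis le_bot)
  then show ?thesis
    using assms(1) by (simp add: velocity_def vector_derivative_within)
qed

lemma velocity_cong:
  assumes "\<And>t. 0 \<le> t \<Longrightarrow> x t = y t" "0 \<le> t"
  shows "velocity x t = velocity y t"
proof -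
  have "(x has_vector_derivative v) (at t within {0..}) \<longleftrightarrow>
      (y has_vector_derivative v) (at t within {0..})" for v
    using has_vector_derivative_transform[of t "{0..}" x y v]
      has_vector_derivative_transform[of t "{0..}" y x v] assms by auto
  then show ?thesis
    by (simp add: velocity_def vector_derivative_def)
qed

lemma differentiable_cong_Ici:
  assumes "\<And>t. 0 \<le> t \<Longrightarrow> x t = y t" "0 \<le> (t::real)"
  shows "x differentiable (at t within {0..}) \<longleftrightarrow> y differentiable (at t within {0..})"
  unfolding differentiable_def
  using has_derivative_transform[of t "{0..}" x y] has_derivative_transform[of t "{0..}" y x] assms
  by auto

text \<open>Values at negative times are arbitrary. A computed derivative matches
  \<open>velocity x\<close> only on \<open>{0..}\<close>, so regularity has to transfer between
  signals that agree there.\<close>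

lemma Cn_signal_cong:
  assumes "\<And>t. 0 \<le> t \<Longrightarrow> x t = y t"
  shows "Cn_signal n x \<longleftrightarrow> Cn_signal n y"
  using assms
proof (induction n arbitrary: x y)
  case 0
  then show ?case
    unfolding Cn_signal.simps by (intro continuous_on_cong) auto
next
  case (Suc n)
  show ?case
    using Suc.IH[of "velocity x" "velocity y"] velocity_cong[OF Suc.prems]
      differentiable_cong_Ici[OF Suc.prems] by simp
qed

lemma Cn_signal_SucI:
  assumes "\<And>t. 0 \<le> t \<Longrightarrow> (x has_vector_derivative x' t) (at t within {0..})" "Cn_signal n x'"
  shows "Cn_signal (Suc n) x"
  using assms Cn_signal_cong[of "velocity x" x' n] velocity_eq[OF assms(1)]
  by (auto intro: differentiableI_vector)

lemma Cn_signal_const: "Cn_signal n (\<lambda>t. c)"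
proof (induction n arbitrary: c)
  case (Suc n)
  show ?case by (rule Cn_signal_SucI[OF has_vector_derivative_const Suc])
qed simp

lemma C1_on_imp_continuous_on: "C1_on D F \<Longrightarrow> continuous_on D F"
  unfolding C1_on_def
  by (meson continuous_on_eq_continuous_within has_derivative_continuous)

text \<open>Chain rule relative to \<open>D\<close>: the signal stays in \<open>D\<close>, so
  derivatives within \<open>D\<close> suffice even where \<open>D\<close> is not open.\<close>

lemma C1_on_compose_signal:
  fixes p :: "real \<Rightarrow> 'a::real_normed_vector" and F :: "'a \<Rightarrow> 'b::real_normed_vector"
  assumes F: "C1_on D F" and pD: "\<And>t. 0 \<le> t \<Longrightarrow> p t \<in> D"
    and p: "\<And>t. 0 \<le> t \<Longrightarrow> (p has_vector_derivative p' t) (at t within {0..})"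
    and p': "continuous_on {0..} p'"
  shows "Cn_signal 1 (\<lambda>t. F (p t))"
proof -
  obtain F' where F': "\<And>q. q \<in> D \<Longrightarrow> (F has_derivative blinfun_apply (F' q)) (at q within D)"
    and cont: "continuous_on D F'"
    using F unfolding C1_on_def by auto
  have "Cn_signal (Suc 0) (\<lambda>t. F (p t))"
  proof (rule Cn_signal_SucI)
    fix t :: real assume t: "0 \<le> t"
    have "(F has_derivative blinfun_apply (F' (p t))) (at (p t) within p ` {0..})"
      by (rule has_derivative_subset[OF F'[OF pD[OF t]]]) (use pD in auto)
    from diff_chain_within[OF p[OF t, unfolded has_vector_derivative_def] this]
    show "((\<lambda>t. F (p t)) has_vector_derivative blinfun_apply (F' (p t)) (p' t)) (at t within {0..})"
      by (simp add: o_def has_vector_derivative_def blinfun.scaleR_right)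
  next
    have "continuous_on {0..} p"
      using p by (auto simp: continuous_on_eq_continuous_within intro: has_vector_derivative_continuous)
    then have "continuous_on {0..} (\<lambda>t. F' (p t))"
      by (rule continuous_on_compose2[OF cont]) (use pD in auto)
    then show "Cn_signal 0 (\<lambda>t. blinfun_apply (F' (p t)) (p' t))"
      using p' by (auto intro!: continuous_intros)
  qed
  then show ?thesis by simp
qed

section \<open>Reduction of the system to constant inputs\<close>

lemma equilibrium_state_unique:
  assumes S: "standing_assumptions S" and eq: "(xs, ws, zs) \<in> equilibria S"
    and p: "p \<in> states S" "dyn S (p, ws) = 0"
  shows "p = xs"
proof -
  obtain \<kappa> where \<kappa>: "\<forall>(xs, ws, zs)\<in>equilibria S. xs = \<kappa> ws"
    using S unfolding standing_assumptions_def by blast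
  \<comment> \<open>With this output, \<open>p\<close> becomes an equilibrium state for the same
    input as \<open>xs\<close>, and \<open>\<kappa>\<close> assigns a single state to that
    input.\<close>
  have "(p, ws, out S (p, ws)) \<in> equilibria S"
    using eq p S by (auto simp: equilibria_def standing_assumptions_def)
  from bspec[OF \<kappa> this] bspec[OF \<kappa> eq] show ?thesis by simp
qed

lemma behaviour_const_inputD:
  assumes "(x, w, z) \<in> behaviour S" "\<And>t. 0 \<le> t \<Longrightarrow> w t = ws"
  shows "trajectory (\<lambda>p. dyn S (p, ws)) (states S) x"
  using assms by (auto simp: behaviour_def trajectory_def)

text \<open>Under constant input, \<open>x\<close> solves an equation with continuously
  differentiable right-hand side, so its derivative is again of class C1, and so is the output.
  Hence velocity dissipativity, which speaks only of such smooth solutions, applies to every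
  trajectory with constant input.\<close>

lemma const_input_behaviour_C:
  assumes S: "standing_assumptions S" and ws: "ws \<in> inputs S"
    and x: "trajectory (\<lambda>p. dyn S (p, ws)) (states S) x"
  shows "(x, \<lambda>t. ws, \<lambda>t. out S (x t, ws)) \<in> behaviour_C S"
proof -
  let ?f = "\<lambda>t. dyn S (x t, ws)"
  have dyn: "C1_on (states S \<times> inputs S) (dyn S)" and out: "C1_on (states S \<times> inputs S) (out S)"
    and outputs: "out S ` (states S \<times> inputs S) \<subseteq> outputs S"
    using S by (auto simp: standing_assumptions_def)
  have mem: "(x t, ws) \<in> states S \<times> inputs S" if "0 \<le> t" for t
    using trajectory_mem[OF x that] ws by simp
  have deriv: "((\<lambda>t. (x t, ws)) has_vector_derivative (?f t, 0)) (at t within {0..})"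
    if "0 \<le> t" for t
    using trajectory_deriv[OF x that] by (intro has_vector_derivative_Pair) auto
  have "continuous_on {0..} (\<lambda>t. (x t, ws))"
    using trajectory_continuous_on[OF x] by (intro continuous_intros)
  then have f: "continuous_on {0..} ?f"
    by (rule continuous_on_compose2[OF C1_on_imp_continuous_on[OF dyn]]) (use mem in auto)
  then have f0: "continuous_on {0..} (\<lambda>t. (?f t, 0 :: 'b))"
    by (intro continuous_intros)
  have "Cn_signal (Suc 1) x"
    by (rule Cn_signal_SucI[OF trajectory_deriv[OF x] C1_on_compose_signal[OF dyn mem deriv f0]])
  then have "Cn_signal 2 x" by (simp add: numeral_2_eq_2)
  moreover have "Cn_signal (Suc 0) x"
    by (rule Cn_signal_SucI[OF trajectory_deriv[OF x]]) (use f in auto)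
  moreover have "Cn_signal 1 (\<lambda>t. out S (x t, ws))"
    by (rule C1_on_compose_signal[OF out mem deriv f0])
  ultimately show ?thesis
    using trajectory_mem[OF x] trajectory_deriv[OF x] ws outputs Cn_signal_const[of 1 ws]
    by (auto simp: behaviour_C_def behaviour_def)
qed

text \<open>The state velocity is the vector field along the trajectory and the input velocity is 0.
  The storage function thus becomes a function of the state, and the supply is evaluated only at
  \<open>(0, z')\<close>.\<close>

lemma velocity_dissipative_const_input:
  fixes S :: "('x::euclidean_space, 'w::euclidean_space, 'z::euclidean_space) nlsys"
  assumes S: "standing_assumptions S" and s: "velocity_dissipative S s"
  obtains V :: "'x \<Rightarrow> real" where "continuous_on UNIV V" "V 0 = 0" "\<And>v. v \<noteq> 0 \<Longrightarrow> 0 < V v"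
    "\<And>ws x t0 t1. ws \<in> inputs S \<Longrightarrow> trajectory (\<lambda>p. dyn S (p, ws)) (states S) x \<Longrightarrow>
       0 \<le> t0 \<Longrightarrow> t0 \<le> t1 \<Longrightarrow>
       (\<lambda>t. s (0, velocity (\<lambda>t. out S (x t, ws)) t)) integrable_on {t0..t1} \<and>
       V (dyn S (x t1, ws)) - V (dyn S (x t0, ws))
         \<le> integral {t0..t1} (\<lambda>t. s (0, velocity (\<lambda>t. out S (x t, ws)) t))"
proof -
  obtain V :: "'x \<Rightarrow> real" where V: "C1_on UNIV V" "class_Q UNIV 0 V"
    and diss: "\<forall>(xv, wv, zv)\<in>behaviour_VF S. \<forall>t0 t1. 0 \<le> t0 \<and> t0 \<le> t1 \<longrightarrow>
         (\<lambda>t. s (wv t, zv t)) integrable_on {t0..t1} \<and>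
         V (xv t1) - V (xv t0) \<le> integral {t0..t1} (\<lambda>t. s (wv t, zv t))"
    using s unfolding velocity_dissipative_def by blast
  obtain a b :: "real \<Rightarrow> real" where ab: "strict_mono_on {0..} a" "a 0 = 0" "b 0 = 0"
    "\<And>v. a (norm v) \<le> V v \<and> V v \<le> b (norm v)"
    using V(2) unfolding class_Q_def by auto
  show thesis
  proof (rule that)
    show "continuous_on UNIV V" using V(1) by (rule C1_on_imp_continuous_on)
    show "V 0 = 0" using ab(4)[of 0] ab by simp
    show "0 < V v" if "v \<noteq> 0" for v
      using strict_mono_onD[OF ab(1), of 0 "norm v"] that ab(2) ab(4)[of v] by force
    fix ws x and t0 t1 :: real
    assume ws: "ws \<in> inputs S" and x: "trajectory (\<lambda>p. dyn S (p, ws)) (states S) x"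
      and t: "0 \<le> t0" "t0 \<le> t1"
    let ?z = "velocity (\<lambda>t. out S (x t, ws))" and ?w = "velocity (\<lambda>t::real. ws)"
    have "(velocity x, ?w, ?z) \<in> behaviour_VF S"
      using const_input_behaviour_C[OF S ws x] by (auto simp: behaviour_VF_def)
    from bspec[OF diss this] t
    have "(\<lambda>t. s (?w t, ?z t)) integrable_on {t0..t1}"
      "V (velocity x t1) - V (velocity x t0) \<le> integral {t0..t1} (\<lambda>t. s (?w t, ?z t))"
      by auto
    \<comment> \<open>The velocity of a constant is determined only on the half-line, so the
      integrands are compared only on \<open>{t0..t1}\<close>.\<close>
    moreover have eq: "s (?w t, ?z t) = s (0, ?z t)" if "t \<in> {t0..t1}" for t
      using velocity_eq[OF has_vector_derivative_const[of ws], of t] t that by simp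
    moreover have "velocity x t = dyn S (x t, ws)" if "0 \<le> t" for t
      using velocity_eq[OF trajectory_deriv[OF x that] that] .
    ultimately show "(\<lambda>t. s (0, ?z t)) integrable_on {t0..t1} \<and>
       V (dyn S (x t1, ws)) - V (dyn S (x t0, ws)) \<le> integral {t0..t1} (\<lambda>t. s (0, ?z t))"
      using t integrable_cong[of "{t0..t1}", OF eq] integral_cong[of "{t0..t1}", OF eq] by auto
  qed
qed

section \<open>Outputs with vanishing supply integral\<close>

lemma nonneg_integral_0_imp_negligible:
  fixes f :: "'n::euclidean_space \<Rightarrow> real"
  assumes f: "f integrable_on A" "\<And>x. x \<in> A \<Longrightarrow> 0 \<le> f x" and 0: "integral A f = 0"
  shows "negligible {x \<in> A. f x \<noteq> 0}"
proof -
  \<comment> \<open>A nonnegative gauge integrable function is Lebesgue integrable, which makes the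
    almost-everywhere criterion available.\<close>
  have ab: "f absolutely_integrable_on A"
    using f by (intro nonnegative_absolutely_integrable_1) auto
  then have "integral\<^sup>L lebesgue (\<lambda>x. indicat_real A x *\<^sub>R f x) = 0"
    using set_lebesgue_integral_eq_integral(2)[OF ab] 0 by (simp add: set_lebesgue_integral_def)
  then have "AE x in lebesgue. indicat_real A x *\<^sub>R f x = 0"
    using ab f(2) by (subst (asm) integral_nonneg_eq_0_iff_AE)
      (auto simp: set_integrable_def indicator_def)
  then obtain N where N: "N \<in> null_sets lebesgue"
    "{x \<in> space lebesgue. indicat_real A x *\<^sub>R f x \<noteq> 0} \<subseteq> N"
    unfolding eventually_ae_filter by blast
  have "{x \<in> A. f x \<noteq> 0} \<subseteq> N"
    using N(2) by (auto simp: indicator_def subset_iff)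
  with N(1) show ?thesis
    unfolding negligible_iff_null_sets[symmetric] by (rule negligible_subset)
qed

text \<open>A nonpositive integrand with nonnegative integral vanishes almost everywhere. As
  \<open>\<sigma>\<close> is negative off 0, \<open>velocity z\<close> is then 0 almost everywhere
  and \<open>z\<close> has no increment. This way no regularity of \<open>\<sigma>\<close>
  enters.\<close>

lemma constant_of_supply_integral_0:
  fixes z :: "real \<Rightarrow> 'z::euclidean_space" and \<sigma> :: "'z \<Rightarrow> real"
  assumes z: "Cn_signal 1 z" and t: "0 \<le> t"
    and \<sigma>: "\<sigma> 0 \<le> 0" "\<And>v. v \<noteq> 0 \<Longrightarrow> \<sigma> v < 0"
    and int: "(\<lambda>\<tau>. \<sigma> (velocity z \<tau>)) integrable_on {0..t}"
      "0 \<le> integral {0..t} (\<lambda>\<tau>. \<sigma> (velocity z \<tau>))"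
  shows "z t = z 0"
proof -
  have \<sigma>_le: "\<sigma> v \<le> 0" for v
    using \<sigma>(1) \<sigma>(2)[of v] by (cases "v = 0") (auto simp: less_imp_le)
  then have "integral {0..t} (\<lambda>\<tau>. \<sigma> (velocity z \<tau>)) \<le> 0"
    using integral_le[OF int(1) integrable_0] by simp
  with int have neg: "negligible {\<tau> \<in> {0..t}. - \<sigma> (velocity z \<tau>) \<noteq> 0}"
    using \<sigma>_le by (intro nonneg_integral_0_imp_negligible) (auto intro: integrable_neg)
  have "(velocity z has_integral 0) {0..t}"
    by (rule has_integral_spike[OF neg, of _ _ "\<lambda>_. 0"]) (use \<sigma> in force)+
  moreover have "(z has_vector_derivative velocity z \<tau>) (at \<tau> within {0..t})" if "\<tau> \<in> {0..t}" for \<tau>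
    unfolding velocity_def
    by (rule has_vector_derivative_within_subset[of _ _ _ "{0..}"])
      (use z that in \<open>auto simp: vector_derivative_works[symmetric]\<close>)
  then have "(velocity z has_integral (z t - z 0)) {0..t}"
    by (intro fundamental_theorem_of_calculus t)
  ultimately have "z t - z 0 = 0"
    by (rule has_integral_unique[symmetric])
  then show ?thesis by simp
qed

text \<open>A time shift of a trajectory with constant output has the same output, so observability
  identifies its initial state with the original one.\<close>

lemma observable_constant_output:
  assumes S: "standing_assumptions S" and ws: "ws \<in> inputs S" and obs: "observable S {\<lambda>t. ws}"
    and y: "trajectory (\<lambda>p. dyn S (p, ws)) (states S) y"
    and out: "\<And>t. 0 \<le> t \<Longrightarrow> out S (y t, ws) = out S (y 0, ws)" and u: "0 \<le> u"
  shows "y u = y 0"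
proof -
  have beh: "(x, \<lambda>t. ws, \<lambda>t. out S (x t, ws)) \<in> behaviour S"
    if "trajectory (\<lambda>p. dyn S (p, ws)) (states S) x" for x
    using const_input_behaviour_C[OF S ws that] by (simp add: behaviour_C_def)
  have uniq: "x t = x' t" if "(x, w, z) \<in> behaviour S" "(x', w, z') \<in> behaviour S" "x 0 = x' 0" "0 \<le> t"
    for x x' w z z' t
    using S that unfolding standing_assumptions_def unique_solutions_def by blast
  \<comment> \<open>Indistinguishability speaks of all behaviours from the two states. By
    uniqueness, one that starts at \<open>y v\<close> is the shift of \<open>y\<close> by
    \<open>v\<close>; the cases \<open>v = u\<close> and \<open>v = 0\<close> are compared.\<close>
  have val: "z t = out S (y 0, ws)"
    if "(x, \<lambda>t. ws, z) \<in> behaviour S" "x 0 = y v" "0 \<le> v" "0 \<le> t" for x z t v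
  proof -
    have "x t = y (v + t)"
      using uniq[OF that(1) beh[OF trajectory_shift[OF y \<open>0 \<le> v\<close>]]] that by simp
    then show ?thesis
      using that out[of "v + t"] by (auto simp: behaviour_def)
  qed
  have "indistinguishable S {\<lambda>t. ws} (y u) (y 0)"
    unfolding indistinguishable_def using val[of _ _ u] val[of _ _ 0] u by auto
  then show ?thesis
    using obs trajectory_mem[OF y] u unfolding observable_def by blast
qed

text \<open>Local compactness, which open and closed state sets have, supplies compact
  neighbourhoods of the equilibrium relative to the state set. They yield both the positive minimum
  of the Lyapunov function on a sphere and the limits of time shifts.\<close>

theorem theorem5:
  fixes S :: "(real ^ 'nx, real ^ 'nw, real ^ 'nz) nlsys"
    and s :: "(real ^ 'nw) \<times> (real ^ 'nz) \<Rightarrow> real"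
  assumes "standing_assumptions S"
    and "locally compact (states S)"
    and "velocity_dissipative S s"
    and "\<forall>zv. s (0, zv) \<le> 0"
  shows "USS S \<and>
    ((\<forall>zv. zv \<noteq> 0 \<longrightarrow> s (0, zv) < 0) \<and> eq_input_observable S \<longrightarrow> USAS S)"
proof -
  let ?X = "states S"
  let ?traj = "\<lambda>ws. trajectory (\<lambda>p. dyn S (p, ws))"
  obtain V :: "real ^ 'nx \<Rightarrow> real"
    where V: "continuous_on UNIV V" "V 0 = 0" "\<And>v. v \<noteq> 0 \<Longrightarrow> 0 < V v"
    and diss: "\<And>ws x t0 t1. ws \<in> inputs S \<Longrightarrow> ?traj ws ?X x \<Longrightarrow> 0 \<le> t0 \<Longrightarrow> t0 \<le> t1 \<Longrightarrow>
       (\<lambda>t. s (0, velocity (\<lambda>t. out S (x t, ws)) t)) integrable_on {t0..t1} \<and>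
       V (dyn S (x t1, ws)) - V (dyn S (x t0, ws))
         \<le> integral {t0..t1} (\<lambda>t. s (0, velocity (\<lambda>t. out S (x t, ws)) t))"
    using velocity_dissipative_const_input[OF assms(1,3)] by blast
  have dyn_cont: "continuous_on ?X (\<lambda>p. dyn S (p, ws))" if "ws \<in> inputs S" for ws
  proof -
    have "continuous_on (?X \<times> inputs S) (dyn S)"
      using assms(1) by (auto simp: standing_assumptions_def intro: C1_on_imp_continuous_on)
    then show ?thesis
      by (rule continuous_on_compose2) (use that in \<open>auto intro!: continuous_intros\<close>)
  qed
  have dec: "V (dyn S (x t, ws)) \<le> V (dyn S (x r, ws))"
    if "ws \<in> inputs S" "?traj ws ?X x" "0 \<le> r" "r \<le> t" for ws x r t
  proof -
    have "integral {r..t} (\<lambda>t. s (0, velocity (\<lambda>t. out S (x t, ws)) t)) \<le> 0"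
      using integral_le[OF conjunct1[OF diss[OF that]] integrable_0] assms(4) by simp
    with diss[OF that] show ?thesis by linarith
  qed
  \<comment> \<open>Shared by both claims: stability uses \<open>r < \<epsilon>\<close>, convergence
    uses also that the trajectory remains in a compact set.\<close>
  have stable: "\<exists>r \<delta>. r < \<epsilon> \<and> 0 < \<delta> \<and> compact (?X \<inter> cball xs r) \<and>
      (\<forall>x. ?traj ws ?X x \<and> norm (x 0 - xs) < \<delta> \<longrightarrow> ?traj ws (?X \<inter> cball xs r) x)"
    if eq: "(xs, ws, zs) \<in> equilibria S" and "0 < \<epsilon>" for xs ws zs \<epsilon>
  proof -
    have mem: "xs \<in> ?X" "ws \<in> inputs S" and 0: "dyn S (xs, ws) = 0"
      using eq by (auto simp: equilibria_def)
    have pos: "0 < V (dyn S (p, ws))" if "p \<in> ?X" "p \<noteq> xs" for p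
      using V(3) equilibrium_state_unique[OF assms(1) eq that(1)] that(2) by blast
    have W: "continuous_on ?X (\<lambda>p. V (dyn S (p, ws)))"
      by (rule continuous_on_compose2[OF V(1) dyn_cont[OF mem(2)]]) simp
    have W0: "V (dyn S (xs, ws)) = 0"
      using 0 V(2) by simp
    obtain r \<delta> where r: "r < \<epsilon>" "0 < \<delta>" "compact (?X \<inter> cball xs r)"
      and stay: "\<And>(x :: real \<Rightarrow> _) t. continuous_on {0..} x \<Longrightarrow> (\<And>t. 0 \<le> t \<Longrightarrow> x t \<in> ?X) \<Longrightarrow>
       (\<And>t. 0 \<le> t \<Longrightarrow> V (dyn S (x t, ws)) \<le> V (dyn S (x 0, ws))) \<Longrightarrow> norm (x 0 - xs) < \<delta> \<Longrightarrow>
       0 \<le> t \<Longrightarrow> x t \<in> ?X \<inter> cball xs r"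
      using Lyapunov_stable[where W="\<lambda>p. V (dyn S (p, ws))", OF assms(2) mem(1) W W0 pos \<open>0 < \<epsilon>\<close>]
      by blast
    have "?traj ws (?X \<inter> cball xs r) x" if x: "?traj ws ?X x" and "norm (x 0 - xs) < \<delta>" for x
      using stay[OF trajectory_continuous_on[OF x] trajectory_mem[OF x] dec[OF mem(2) x order_refl]]
        that trajectory_deriv[OF x] unfolding trajectory_def by blast
    with r show ?thesis by blast
  qed
  have near: "norm (x t - xs) < \<epsilon>" if "?traj ws (?X \<inter> cball xs r) x" "r < \<epsilon>" "0 \<le> t" for ws x xs r \<epsilon> t
    using trajectory_mem[OF that(1,3)] that(2) by (auto simp: dist_norm norm_minus_commute)
  have "USS S"
    unfolding USS_def
  proof (clarify)
    fix xs ws zs and \<epsilon> :: real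
    assume eq: "(xs, ws, zs) \<in> equilibria S" and "0 < \<epsilon>"
    obtain r \<delta> where r: "r < \<epsilon>" "0 < \<delta>"
      and stay: "\<And>x. ?traj ws ?X x \<Longrightarrow> norm (x 0 - xs) < \<delta> \<Longrightarrow> ?traj ws (?X \<inter> cball xs r) x"
      using stable[OF eq \<open>0 < \<epsilon>\<close>] by blast
    then show "\<exists>\<delta>>0. \<forall>(x, w, z)\<in>behaviour S. (\<forall>t\<ge>0. w t = ws) \<and> norm (x 0 - xs) < \<delta> \<longrightarrow>
         (\<forall>t\<ge>0. norm (x t - xs) < \<epsilon>)"
      using near[OF stay[OF behaviour_const_inputD] r(1)] by blast
  qed
  moreover have "USAS S"
    if neg: "\<And>zv. zv \<noteq> 0 \<Longrightarrow> s (0, zv) < 0" and obs: "eq_input_observable S"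
    unfolding USAS_def
  proof (clarify)
    fix xs ws zs and \<epsilon> :: real
    assume eq: "(xs, ws, zs) \<in> equilibria S" and "0 < \<epsilon>"
    obtain r \<delta> where r: "r < \<epsilon>" "0 < \<delta>" and K: "compact (?X \<inter> cball xs r)"
      and stay: "\<And>x. ?traj ws ?X x \<Longrightarrow> norm (x 0 - xs) < \<delta> \<Longrightarrow> ?traj ws (?X \<inter> cball xs r) x"
      using stable[OF eq \<open>0 < \<epsilon>\<close>] by blast
    have ws: "ws \<in> inputs S" and obs_ws: "observable S {\<lambda>t. ws}"
      using eq obs by (auto simp: equilibria_def eq_inputs_def eq_input_observable_def)
    have rest: "y 0 = xs"
      if y: "?traj ws ?X y" and W: "\<And>t. 0 \<le> t \<Longrightarrow> V (dyn S (y t, ws)) = V (dyn S (y 0, ws))" for y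
    proof -
      have "Cn_signal 1 (\<lambda>t. out S (y t, ws))"
        using const_input_behaviour_C[OF assms(1) ws y] by (simp add: behaviour_C_def)
      \<comment> \<open>Equal storage at times 0 and \<open>t\<close> turns the dissipation
        inequality into nonnegativity of the supply integral, which forces a constant
        output.\<close>
      then have "out S (y t, ws) = out S (y 0, ws)" if "0 \<le> t" for t
        using constant_of_supply_integral_0[of "\<lambda>t. out S (y t, ws)" t "\<lambda>v. s (0, v)"]
          diss[OF ws y order_refl that] W[OF that] neg assms(4) that by simp
      then have const: "y t = y 0" if "0 \<le> t" for t
        using observable_constant_output[OF assms(1) ws obs_ws y] that by blast
      \<comment> \<open>The constant \<open>y\<close> has derivative 0, which must equal the vector
        field at \<open>y 0\<close>; so \<open>y 0\<close> is the equilibrium state for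
        \<open>ws\<close>.\<close>
      have "(y has_vector_derivative 0) (at 0 within {0..})"
        by (rule has_vector_derivative_transform[of _ _ _ "\<lambda>_. y 0"]) (auto intro: const)
      then have "dyn S (y 0, ws) = 0"
        using velocity_eq trajectory_deriv[OF y] by (metis order_refl)
      then show ?thesis
        using equilibrium_state_unique[OF assms(1) eq] trajectory_mem[OF y order_refl] by blast
    qed
    have conv: "(x \<longlongrightarrow> xs) at_top" if x: "?traj ws (?X \<inter> cball xs r) x" for x
    proof (rule LaSalle[OF K _ _ x])
      let ?K = "?X \<inter> cball xs r"
      show dynK: "continuous_on ?K (\<lambda>p. dyn S (p, ws))"
        using dyn_cont[OF ws] by (rule continuous_on_subset) auto
      show "continuous_on ?K (\<lambda>p. V (dyn S (p, ws)))"
        by (rule continuous_on_compose2[OF V(1) dynK]) simp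
      show "V (dyn S (x t, ws)) \<le> V (dyn S (x u, ws))" if "0 \<le> u" "u \<le> t" for u t
        using dec[OF ws trajectory_mono[OF x inf_le1] that] .
    qed (use rest trajectory_mono[OF _ inf_le1] in blast)
    then have "((\<lambda>t. norm (x t - xs)) \<longlongrightarrow> 0) at_top" if "?traj ws (?X \<inter> cball xs r) x" for x
      using that by (simp add: LIM_zero_iff tendsto_norm_zero_iff)
    then show "\<exists>\<delta>>0. \<forall>(x, w, z)\<in>behaviour S. (\<forall>t\<ge>0. w t = ws) \<and> norm (x 0 - xs) < \<delta> \<longrightarrow>
         (\<forall>t\<ge>0. norm (x t - xs) < \<epsilon>) \<and> ((\<lambda>t. norm (x t - xs)) \<longlongrightarrow> 0) at_top"
      using near[OF stay[OF behaviour_const_inputD] r(1)] stay[OF behaviour_const_inputD] r(2)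
      by blast
  qed
  ultimately show ?thesis by blast
qed

end
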